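(* There exist positive integers $n_1, n_2$ with $n_1 + n_2 \geq 3$ and a set $S$ of the form $$S = \left\{ (x,y) \in [0,1]^{n_1}\times[0,1]^{n_2} \;\middle|\; x^\top Q_k y + a_k^\top x + b_k^\top y + c_k = 0,\; k \in \{1,2\} \right\},$$ with $Q_k \in \mathbb{R}^{n_1\times n_2}$, $a_k\in\mathbb{R}^{n_1}$, $b_k \in \mathbb{R}^{n_2}$, $c_k \in \mathbb{R}$ for $k\in\{1,2\}$, such that $S$ is nonempty, the two constraints are independent, and the aggregation closure of $S$ over $\mathbb{R}^2$ is not equal to the convex hull of $S$, that is, $$\operatorname{conv}(S) \subsetneq \bigcap_{\lambda \in \mathbb{R}^2} \operatorname{conv}(S_\lambda).$$
   Context: $\operatorname{conv}(\cdot)$ denotes the convex hull. For $\lambda = (\lambda_1,\lambda_2)\in\mathbb{R}^2$, the aggregation $S_\lambda$ of $S$ is $$S_\lambda = \left\{ (x,y)\in[0,1]^{n_1}\times[0,1]^{n_2} \;\middle|\; \sum_{k=1}^{2}\lambda_k\left(x^\top Q_k y + a_k^\top x + b_k^\top y + c_k\right) = 0 \right\}.$$ The aggregation closure of $S$ over $T\subseteq\mathbb{R}^2$ is the set $\bigcap_{\lambda\in T}\operatorname{conv}(S_\lambda)$. The two constraints are called independent if there is no $\mu\in\mathbb{R}$ such that $x^\top Q_1 y + a_1^\top x + b_1^\top y + c_1 = \mu\,(x^\top Q_2 y + a_2^\top x + b_2^\top y + c_2)$ identically in $(x,y)$. *)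

theory Defs
  imports "HOL-Analysis.Analysis" "HOL-Analysis.Finite_Function_Topology"
begin

(* The dimensions n1, n2 are existentially quantified, so they cannot be types.  R^n is
   therefore the linear subspace, spanned by the first n unit vectors, of the real vector
   space of finitely supported sequences; indices run over 0, ..., n - 1.  In this way the
   library's convex hull applies to subsets of R^n1 x R^n2 for all n1, n2. *)

type_synonym rvec = "nat \<Rightarrow>\<^sub>0 real"

definition Rn :: "nat \<Rightarrow> rvec set" where
  "Rn n = {x. Poly_Mapping.keys x \<subseteq> {..<n}}"

definition unit_cube :: "nat \<Rightarrow> rvec set" where
  "unit_cube n = {x \<in> Rn n. \<forall>i<n. Poly_Mapping.lookup x i \<in> {0..1}}"

(* Coefficient families are plain functions: only the entries Q i j, a i, b j with
   i < n1 and j < n2 enter, so they stand for an n1 x n2 matrix and vectors of length n1, n2. *)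
definition bilinear_fun ::
  "nat \<Rightarrow> nat \<Rightarrow> (nat \<Rightarrow> nat \<Rightarrow> real) \<Rightarrow> (nat \<Rightarrow> real) \<Rightarrow> (nat \<Rightarrow> real) \<Rightarrow> real \<Rightarrow> rvec \<Rightarrow> rvec \<Rightarrow> real" where
  "bilinear_fun n1 n2 Q a b c x y =
     (\<Sum>i<n1. \<Sum>j<n2. Poly_Mapping.lookup x i * Q i j * Poly_Mapping.lookup y j)
     + (\<Sum>i<n1. a i * Poly_Mapping.lookup x i) + (\<Sum>j<n2. b j * Poly_Mapping.lookup y j) + c"

(* The two constraints f k = 0 are indexed by the two-element type 2, whose elements are
   1 and 2; multipliers are vectors in real ^ 2. *)

definition feasible_set :: "nat \<Rightarrow> nat \<Rightarrow> (2 \<Rightarrow> rvec \<Rightarrow> rvec \<Rightarrow> real) \<Rightarrow> (rvec \<times> rvec) set" where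
  "feasible_set n1 n2 f = {(x, y) \<in> unit_cube n1 \<times> unit_cube n2. \<forall>k. f k x y = 0}"

definition aggregation ::
  "nat \<Rightarrow> nat \<Rightarrow> (2 \<Rightarrow> rvec \<Rightarrow> rvec \<Rightarrow> real) \<Rightarrow> real ^ 2 \<Rightarrow> (rvec \<times> rvec) set" where
  "aggregation n1 n2 f l =
     {(x, y) \<in> unit_cube n1 \<times> unit_cube n2. (\<Sum>k\<in>UNIV. l $ k * f k x y) = 0}"

definition aggregation_closure ::
  "nat \<Rightarrow> nat \<Rightarrow> (2 \<Rightarrow> rvec \<Rightarrow> rvec \<Rightarrow> real) \<Rightarrow> (real ^ 2) set \<Rightarrow> (rvec \<times> rvec) set" where
  "aggregation_closure n1 n2 f T = (\<Inter>l\<in>T. convex hull (aggregation n1 n2 f l))"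

(* Not symmetric in the two constraints: only f 1 = m * f 2 is excluded. *)
definition independent_constraints ::
  "nat \<Rightarrow> nat \<Rightarrow> (2 \<Rightarrow> rvec \<Rightarrow> rvec \<Rightarrow> real) \<Rightarrow> bool" where
  "independent_constraints n1 n2 f \<longleftrightarrow>
     \<not> (\<exists>m::real. \<forall>x\<in>Rn n1. \<forall>y\<in>Rn n2. f 1 x y = m * f 2 x y)"

end

theory Submission
  imports Defs
begin

text \<open>
  Take \<open>n1 = 1\<close>, \<open>n2 = 2\<close> and \<open>u = y - (1/2, 1/2)\<close>, and let
  \<open>(f 1, f 2) = (1 - x) u + x J u\<close> with \<open>J\<close> the rotation by a right angle.  The matrix
  \<open>(1 - x) I + x J\<close> has determinant \<open>(1 - x)^2 + x^2 > 0\<close>, so the feasible set is the segment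
  \<open>u = 0\<close>.  An aggregation, however, contains a line segment through \<open>u = 0\<close> in each of the two
  faces \<open>x = 0\<close> and \<open>x = 1\<close>, and these two segments are orthogonal; midpoints of their points
  cover a neighbourhood of \<open>u = 0\<close> in the slice \<open>x = 1/2\<close>, of a size independent of the multipliers.
\<close>

text \<open>Scaling is defined through the abstraction function, so coordinates can be read off only
  once the scaled support is known to be finite.\<close>

lemma lookup_scaleR [simp]:
  fixes x :: "'a \<Rightarrow>\<^sub>0 'b::real_vector"
  shows "Poly_Mapping.lookup (r *\<^sub>R x) i = r *\<^sub>R Poly_Mapping.lookup x i"
proof -
  have "finite {i. r *\<^sub>R Poly_Mapping.lookup x i \<noteq> 0}"
    by (rule finite_subset[OF _ finite_keys[of x]]) (auto simp: in_keys_iff)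
  then show ?thesis
    by (simp add: scaleR_poly_mapping_def)
qed

definition vec1 :: "real \<Rightarrow> rvec" where
  "vec1 s = Poly_Mapping.single 0 s"

definition vec2 :: "real \<Rightarrow> real \<Rightarrow> rvec" where
  "vec2 s t = Poly_Mapping.single 0 s + Poly_Mapping.single 1 t"

lemma lookup_vec1 [simp]: "Poly_Mapping.lookup (vec1 s) 0 = s"
  by (simp add: vec1_def)

lemma lookup_vec2 [simp]:
  "Poly_Mapping.lookup (vec2 s t) 0 = s" "Poly_Mapping.lookup (vec2 s t) (Suc 0) = t"
  by (simp_all add: vec2_def lookup_add lookup_single)

lemma vec1_in_Rn: "vec1 s \<in> Rn 1"
  by (auto simp: vec1_def Rn_def)

lemma vec2_in_Rn: "vec2 s t \<in> Rn 2"
  using keys_add[of "Poly_Mapping.single 0 s" "Poly_Mapping.single (1::nat) t"]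
  by (fastforce simp: vec2_def Rn_def split: if_splits)

lemma vec1_in_unit_cube: "vec1 s \<in> unit_cube (Suc 0) \<longleftrightarrow> s \<in> {0..1}"
  using vec1_in_Rn[of s] by (auto simp: unit_cube_def)

lemma vec2_in_unit_cube: "vec2 s t \<in> unit_cube 2 \<longleftrightarrow> s \<in> {0..1} \<and> t \<in> {0..1}"
  using vec2_in_Rn by (auto simp: unit_cube_def less_2_cases_iff)

lemma midpoint_vec:
  "midpoint (vec1 s, vec2 t u) (vec1 s', vec2 t' u')
     = (vec1 ((s + s') / 2), vec2 ((t + t') / 2) ((u + u') / 2))"
  by (intro prod_eqI poly_mapping_eqI)
    (simp_all add: midpoint_def vec1_def vec2_def lookup_add lookup_single when_def)

text \<open>This and the next two definitions hold the coefficients of the two coordinates of (1 -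
  x) d + x J d, expanded for d = y - (1/2, 1/2) and J(d0, d1) = (-d1, d0). The constant term is -1/2
  in both.\<close>

definition rot_quad :: "2 \<Rightarrow> nat \<Rightarrow> nat \<Rightarrow> real" where
  "rot_quad k i j = (if k = 1 then -1 else if j = 0 then 1 else -1)"

definition rot_lin1 :: "2 \<Rightarrow> nat \<Rightarrow> real" where
  "rot_lin1 k i = (if k = 1 then 1 else 0)"

definition rot_lin2 :: "2 \<Rightarrow> nat \<Rightarrow> real" where
  "rot_lin2 k j = (if k = 1 then of_bool (j = 0) else of_bool (j = 1))"

definition rot_con :: "2 \<Rightarrow> rvec \<Rightarrow> rvec \<Rightarrow> real" where
  "rot_con k = bilinear_fun 1 2 (rot_quad k) (rot_lin1 k) (rot_lin2 k) (- 1/2)"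

lemma rot_con_1:
  "rot_con 1 x y = (1 - Poly_Mapping.lookup x 0) * (Poly_Mapping.lookup y 0 - 1/2)
     - Poly_Mapping.lookup x 0 * (Poly_Mapping.lookup y 1 - 1/2)"
  by (simp add: rot_con_def bilinear_fun_def rot_quad_def rot_lin1_def rot_lin2_def
      numeral_2_eq_2 field_simps)

lemma rot_con_2:
  "rot_con 2 x y = (1 - Poly_Mapping.lookup x 0) * (Poly_Mapping.lookup y 1 - 1/2)
     + Poly_Mapping.lookup x 0 * (Poly_Mapping.lookup y 0 - 1/2)"
  by (simp add: rot_con_def bilinear_fun_def rot_quad_def rot_lin1_def rot_lin2_def
      numeral_2_eq_2 field_simps)

text \<open>The matrix (1 - s) I + s J multiplies squared lengths by (1 - s)^2 + s^2, which vanishes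
  for no real s, so only the zero vector is sent to zero.\<close>

lemma rot_con_zero_iff:
  "(\<forall>k. rot_con k x y = 0) \<longleftrightarrow> Poly_Mapping.lookup y 0 = 1/2 \<and> Poly_Mapping.lookup y 1 = 1/2"
proof -
  define s u v where "s = Poly_Mapping.lookup x 0" and "u = Poly_Mapping.lookup y 0 - 1/2"
    and "v = Poly_Mapping.lookup y 1 - 1/2"
  have "u = 0 \<and> v = 0" if eqs: "(1 - s) * u - s * v = 0" "(1 - s) * v + s * u = 0"
  proof -
    have "((1 - s)\<^sup>2 + s\<^sup>2) * (u\<^sup>2 + v\<^sup>2) = ((1 - s) * u - s * v)\<^sup>2 + ((1 - s) * v + s * u)\<^sup>2"
      by algebra
    also have "\<dots> = 0"
      using eqs by simp
    finally show ?thesis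
      by (auto simp: sum_power2_eq_zero_iff)
  qed
  then have "(1 - s) * u - s * v = 0 \<and> (1 - s) * v + s * u = 0 \<longleftrightarrow> u = 0 \<and> v = 0"
    by auto
  then show ?thesis
    by (simp add: forall_2 rot_con_1 rot_con_2 s_def u_def v_def)
qed

lemma rot_con_independent: "independent_constraints 1 2 rot_con"
  unfolding independent_constraints_def
proof
  assume "\<exists>m::real. \<forall>x\<in>Rn 1. \<forall>y\<in>Rn 2. rot_con 1 x y = m * rot_con 2 x y"
  then obtain m :: real where "\<And>t. rot_con 1 (vec1 0) (vec2 1 t) = m * rot_con 2 (vec1 0) (vec2 1 t)"
    using vec1_in_Rn vec2_in_Rn by blast
  \<comment> \<open>At x = 0 the constraints are y0 - 1/2 and y1 - 1/2; the points (1, 0) and (1, 1)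
    force m = -1 and m = 1.\<close>
  from this[of 0] this[of 1] show False
    by (simp add: rot_con_1 rot_con_2)
qed

lemma mult_le_sum_squares: "\<bar>p * q\<bar> \<le> p\<^sup>2 + q\<^sup>2" for p q :: real
  using sum_squares_bound[of "\<bar>p\<bar>" "\<bar>q\<bar>"] abs_ge_zero[of "p * q"]
  unfolding abs_mult power2_abs by linarith

lemma mem_aggregation_hull:
  "(vec1 (1/2), vec2 (3/4) (1/2)) \<in> convex hull (aggregation 1 2 rot_con l)"
proof -
  define p q where "p = l $ 1" and "q = l $ 2"
  have agg: "(vec1 s, vec2 t u) \<in> aggregation 1 2 rot_con l \<longleftrightarrow>
      s \<in> {0..1} \<and> t \<in> {0..1} \<and> u \<in> {0..1} \<and>
      p * ((1 - s) * (t - 1/2) - s * (u - 1/2)) + q * ((1 - s) * (u - 1/2) + s * (t - 1/2)) = 0"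
    for s t u
    by (simp add: aggregation_def vec1_in_unit_cube vec2_in_unit_cube sum_2 rot_con_1 rot_con_2
        p_def q_def)
  show ?thesis
  proof (cases "p = 0 \<and> q = 0")
    \<comment> \<open>For the zero multiplier the aggregation is the whole box, so the point itself
      lies in it.\<close>
    case True
    then show ?thesis
      using agg by (intro hull_inc) simp
  next
    case False
    define D where "D = p\<^sup>2 + q\<^sup>2"
    have D: "D > 0"
      using False by (auto simp: D_def sum_power2_gt_zero_iff)
    \<comment> \<open>On the face x = 0 the aggregated equation puts d on the line through (q, -p),
      on x = 1 on the line through (p, q). The vectors (u, -w) and (v, w) are the orthogonal
      projections of (1/2, 0) onto these lines. They sum to (1/2, 0), so their midpoint is (1/4, 0)
      for every multiplier.\<close>
    define u v w where "u = q\<^sup>2 / (2 * D)" and "v = p\<^sup>2 / (2 * D)" and "w = p * q / (2 * D)"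
    \<comment> \<open>Each offset from the centre must be at most 1/2 in absolute value for the
      endpoints to stay in the cube; for u and v this follows from nonnegativity and u + v =
      1/2.\<close>
    have "\<bar>w\<bar> \<le> 1/2"
      using D mult_le_sum_squares[of p q] by (simp add: w_def flip: D_def)
    then have "w \<le> 1/2" "- w \<le> 1/2"
      by linarith+
    moreover have "0 \<le> u" "0 \<le> v"
      using D by (simp_all add: u_def v_def)
    moreover have uv: "u + v = 1/2"
      using D by (simp add: u_def v_def flip: add_divide_distrib) (simp add: D_def)
    \<comment> \<open>These are the aggregated equations at the endpoints on x = 0 and x =
      1.\<close>
    moreover have "p * u = q * w" "p * w = q * v"
      by (simp_all add: u_def v_def w_def power2_eq_square)
    ultimately have "(vec1 0, vec2 (1/2 + u) (1/2 - w)) \<in> aggregation 1 2 rot_con l"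
      and "(vec1 1, vec2 (1/2 + v) (1/2 + w)) \<in> aggregation 1 2 rot_con l"
      unfolding agg by simp_all
    then have "midpoint (vec1 0, vec2 (1/2 + u) (1/2 - w)) (vec1 1, vec2 (1/2 + v) (1/2 + w))
        \<in> convex hull (aggregation 1 2 rot_con l)"
      unfolding midpoint_def scaleR_add_right
      by (intro convexD[OF convex_convex_hull] hull_inc) auto
    moreover have "(1/2 + u + (1/2 + v)) / 2 = 3/4"
      using uv by simp
    moreover have "(0 + 1) / 2 = (1/2 :: real)" "(1/2 - w + (1/2 + w)) / 2 = 1/2"
      by simp_all
    ultimately show ?thesis
      by (simp only: midpoint_vec)
  qed
qed

lemma convex_lookup_snd_eq:
  "convex {z :: rvec \<times> rvec. Poly_Mapping.lookup (snd z) i = t}"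
  by (rule convexI) (simp add: lookup_add flip: distrib_right)

text \<open>The feasible set lies in a hyperplane, hence so does its hull; this excludes the point
  with first y-coordinate 3/4.\<close>

lemma feasible_hull_slice:
  "convex hull (feasible_set 1 2 rot_con) \<subseteq> {z. Poly_Mapping.lookup (snd z) 0 = 1/2}"
  by (intro hull_minimal convex_lookup_snd_eq) (auto simp: feasible_set_def rot_con_zero_iff)

text \<open>A common zero of both constraints is a zero of each of their linear combinations, and
  taking hulls is monotone.\<close>

lemma feasible_hull_subset_closure:
  "convex hull (feasible_set n1 n2 f) \<subseteq> aggregation_closure n1 n2 f T"
  unfolding aggregation_closure_def
  by (intro INT_greatest hull_mono) (auto simp: feasible_set_def aggregation_def)

theorem theorem3:
  shows "\<exists>(n1::nat) (n2::nat) (Q :: 2 \<Rightarrow> nat \<Rightarrow> nat \<Rightarrow> real)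
           (a :: 2 \<Rightarrow> nat \<Rightarrow> real) (b :: 2 \<Rightarrow> nat \<Rightarrow> real) (c :: 2 \<Rightarrow> real).
           0 < n1 \<and> 0 < n2 \<and> 3 \<le> n1 + n2 \<and>
           (let f = (\<lambda>k. bilinear_fun n1 n2 (Q k) (a k) (b k) (c k)) in
             feasible_set n1 n2 f \<noteq> {} \<and>
             independent_constraints n1 n2 f \<and>
             convex hull (feasible_set n1 n2 f) \<subset> aggregation_closure n1 n2 f UNIV)"
proof -
  have "(vec1 0, vec2 (1/2) (1/2)) \<in> feasible_set 1 2 rot_con"
    by (simp add: feasible_set_def vec1_in_unit_cube vec2_in_unit_cube rot_con_zero_iff)
  then have nonempty: "feasible_set 1 2 rot_con \<noteq> {}"
    by blast
  have "(vec1 (1/2), vec2 (3/4) (1/2)) \<in> aggregation_closure 1 2 rot_con UNIV"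
    unfolding aggregation_closure_def using mem_aggregation_hull by blast
  moreover have "(vec1 (1/2), vec2 (3/4) (1/2)) \<notin> convex hull (feasible_set 1 2 rot_con)"
    using feasible_hull_slice by force
  ultimately have strict:
    "convex hull (feasible_set 1 2 rot_con) \<subset> aggregation_closure 1 2 rot_con UNIV"
    using feasible_hull_subset_closure by blast
  have "(\<lambda>k. bilinear_fun 1 2 (rot_quad k) (rot_lin1 k) (rot_lin2 k) (- 1/2)) = rot_con"
    by (simp add: fun_eq_iff rot_con_def)
  then show ?thesis
    using nonempty rot_con_independent strict
    by (intro exI[of _ 1] exI[of _ 2] exI[of _ rot_quad] exI[of _ rot_lin1] exI[of _ rot_lin2]
        exI[of _ "\<lambda>_. - 1/2"]) (simp add: Let_def)
qed

end
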